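(* The signature $\Sigma_{SETAF}^{\mathit{prf}_{\mathcal L}}=\{\mathit{prf}_{\mathcal L}(F)\mid F\text{ a SETAF}\}$ is given by exactly all non-empty sets $\mathbb L$ of labellings such that: 1. all labellings $\lambda\in\mathbb L$ have the same domain $\mathrm{Args}_{\mathbb L}$; 2. if $\lambda\in\mathbb L$ assigns one argument to $\mathrm{out}$ then it also assigns an argument to $\mathrm{in}$; 3. for arbitrary $\lambda_1,\lambda_2\in\mathbb L$ with $\lambda_1\neq\lambda_2$ there is an argument $a$ such that $\lambda_1(a)=\mathrm{in}$ and $\lambda_2(a)=\mathrm{out}$.
   Context: A SETAF is a pair $F=(A,R)$ with $A$ a finite set (of arguments) and $R\subseteq(2^A\setminus\{\emptyset\})\times A$. A labelling of $F$ is a total function $\lambda:A\to\{\mathrm{in},\mathrm{out},\mathrm{undec}\}$; $\lambda_x=\{a\in A\mid\lambda(a)=x\}$. In general, a labelling is such a function on some finite set of arguments (its domain). A labelling $\lambda$ is conflict-free in $F$ if (i) for all $(B,a)\in R$, either $\lambda(a)\neq\mathrm{in}$ or there is $b\in B$ with $\lambda(b)\ne\mathrm{in}$; and (ii) for all $a\in A$, if $\lambda(a)=\mathrm{out}$ then there is $(B,a)\in R$ with $\lambda(b)=\mathrm{in}$ for all $b\in B$. A conflict-free labelling $\lambda$ is complete in $F$ iff for all $a\in A$: $\lambda(a)=\mathrm{in}$ iff for all $(B,a)\in R$ there is $b\in B$ with $\lambda(b)=\mathrm{out}$; and $\lambda(a)=\mathrm{out}$ iff there is $(B,a)\in R$ with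 $\lambda(b)=\mathrm{in}$ for all $b\in B$. It is preferred in $F$ iff it is complete and there is no complete $\lambda'$ in $F$ with $\lambda'_{\mathrm{in}}\supsetneq\lambda_{\mathrm{in}}$. $\mathit{prf}_{\mathcal L}(F)$ is the set of all preferred labellings of $F$. *)

theory Defs
  imports Main
begin

datatype label = In | Out | Undec

record 'a setaf =
  args :: "'a set"
  atts :: "('a set \<times> 'a) set"

definition is_setaf :: "'a setaf \<Rightarrow> bool" where
  "is_setaf F \<longleftrightarrow> finite (args F) \<and> atts F \<subseteq> (Pow (args F) - {{}}) \<times> args F"

(* A labelling with domain A is a partial map with "dom" equal to A, so labellings
   over different argument sets are different objects. *)
type_synonym 'a labelling = "'a \<rightharpoonup> label"

definition is_labelling :: "'a labelling \<Rightarrow> bool" where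
  "is_labelling l \<longleftrightarrow> finite (dom l)"

definition labelled :: "'a labelling \<Rightarrow> label \<Rightarrow> 'a set" where
  "labelled l x = {a \<in> dom l. l a = Some x}"

definition conflict_free :: "'a setaf \<Rightarrow> 'a labelling \<Rightarrow> bool" where
  "conflict_free F l \<longleftrightarrow>
     dom l = args F \<and>
     (\<forall>(B, a) \<in> atts F. l a \<noteq> Some In \<or> (\<exists>b\<in>B. l b \<noteq> Some In)) \<and>
     (\<forall>a \<in> args F. l a = Some Out \<longrightarrow> (\<exists>B. (B, a) \<in> atts F \<and> (\<forall>b\<in>B. l b = Some In)))"

definition complete :: "'a setaf \<Rightarrow> 'a labelling \<Rightarrow> bool" where
  "complete F l \<longleftrightarrow>
     conflict_free F l \<and>
     (\<forall>a \<in> args F.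
        (l a = Some In \<longleftrightarrow> (\<forall>B. (B, a) \<in> atts F \<longrightarrow> (\<exists>b\<in>B. l b = Some Out))) \<and>
        (l a = Some Out \<longleftrightarrow> (\<exists>B. (B, a) \<in> atts F \<and> (\<forall>b\<in>B. l b = Some In))))"

definition preferred :: "'a setaf \<Rightarrow> 'a labelling \<Rightarrow> bool" where
  "preferred F l \<longleftrightarrow>
     complete F l \<and> \<not> (\<exists>l'. complete F l' \<and> labelled l In \<subset> labelled l' In)"

definition prf_labellings :: "'a setaf \<Rightarrow> 'a labelling set" where
  "prf_labellings F = {l. preferred F l}"

definition setaf_signature :: "('a setaf \<Rightarrow> 'a labelling set) \<Rightarrow> 'a labelling set set" where
  "setaf_signature \<sigma> = {\<sigma> F | F. is_setaf F}"

end

(* A preferred labelling is determined by its In-set, and the In-sets of preferred labellings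
   are the maximal admissible sets; hence any admissible set extends to a preferred labelling.
   If l1 has no In-argument that is Out in l2, the union of the two In-sets is admissible,
   so maximality forces l1 = l2; this gives condition 3. Conversely L is realised by letting,
   for each l in L with In-set I, I attack every Out-argument a and I \<union> {a} attack every
   Undec-argument a. Condition 3 makes each l in L complete, and no complete labelling
   extends I. *)
theory Submission
  imports Defs
begin

lemma mem_labelled [simp]: "a \<in> labelled l x \<longleftrightarrow> l a = Some x"
  by (auto simp: labelled_def)

section \<open>Admissible sets\<close>

definition attacked :: "'a setaf \<Rightarrow> 'a set \<Rightarrow> 'a \<Rightarrow> bool" where
  "attacked F S a \<longleftrightarrow> (\<exists>B. (B, a) \<in> atts F \<and> B \<subseteq> S)"

text \<open>Dung's admissible sets carried over to set attacks: conflict-free and self-defending.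
  Working with sets rather than labellings makes unions and maximal elements available.\<close>

definition admissible :: "'a setaf \<Rightarrow> 'a set \<Rightarrow> bool" where
  "admissible F S \<longleftrightarrow> S \<subseteq> args F \<and> (\<forall>a\<in>S. \<not> attacked F S a) \<and>
     (\<forall>B a. (B, a) \<in> atts F \<longrightarrow> a \<in> S \<longrightarrow> (\<exists>b\<in>B. attacked F S b))"

text \<open>For admissible \<open>S\<close> the tests for In and Out exclude each other, so their
  order does not matter.\<close>

definition set_labelling :: "'a setaf \<Rightarrow> 'a set \<Rightarrow> 'a labelling" where
  "set_labelling F S a =
     (if a \<notin> args F then None
      else Some (if a \<in> S then In else if attacked F S a then Out else Undec))"

lemma attacked_mono: "attacked F S a \<Longrightarrow> S \<subseteq> T \<Longrightarrow> attacked F T a"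
  unfolding attacked_def by blast

section \<open>Complete labellings and their In-sets\<close>

lemma complete_dom: "complete F l \<Longrightarrow> dom l = args F"
  by (simp add: complete_def conflict_free_def)

text \<open>Attacks of a SETAF target only its arguments, so the Out-clause of completeness extends
  to every \<open>a\<close>, without a membership condition.\<close>

lemma complete_Out_iff:
  assumes "is_setaf F" "complete F l"
  shows "l a = Some Out \<longleftrightarrow> attacked F (labelled l In) a"
proof -
  have "a \<in> args F" if "l a = Some Out \<or> attacked F (labelled l In) a"
    using that assms complete_dom[OF assms(2)] by (auto simp: is_setaf_def attacked_def)
  moreover have "l a = Some Out \<longleftrightarrow> (\<exists>B. (B, a) \<in> atts F \<and> (\<forall>b\<in>B. l b = Some In))"
    if "a \<in> args F"
    using assms(2) that by (simp add: complete_def)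
  ultimately show ?thesis
    unfolding attacked_def subset_iff mem_labelled by blast
qed

text \<open>The In-set fixes the Out-set by \<open>complete_Out_iff\<close>; the rest of the common
  domain is Undec.\<close>

lemma complete_eqI:
  assumes "is_setaf F" "complete F l" "complete F l'" "labelled l In = labelled l' In"
  shows "l = l'"
proof
  fix a
  have "l a = Some In \<longleftrightarrow> l' a = Some In" using assms(4) by (metis mem_labelled)
  moreover have "l a = Some Out \<longleftrightarrow> l' a = Some Out"
    using assms by (simp add: complete_Out_iff)
  moreover have "l a = None \<longleftrightarrow> l' a = None"
    using complete_dom[OF assms(2)] complete_dom[OF assms(3)] by (metis domIff)
  ultimately show "l a = l' a"
    by (cases "l a"; cases "l' a"; cases "the (l a)"; cases "the (l' a)") simp_all
qed

lemma complete_In_imp_attacked: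
  assumes "is_setaf F" "complete F l" "l a = Some In" "(B, a) \<in> atts F"
  shows "\<exists>b\<in>B. l b = Some Out"
proof -
  have "a \<in> args F" using complete_dom[OF assms(2)] assms(3) by blast
  then show ?thesis using assms(2-4) by (simp add: complete_def)
qed

lemma complete_imp_admissible:
  assumes "is_setaf F" "complete F l"
  shows "admissible F (labelled l In)"
  unfolding admissible_def
proof (intro conjI allI impI ballI)
  show "labelled l In \<subseteq> args F"
    using complete_dom[OF assms(2)] by auto
  show "\<not> attacked F (labelled l In) a" if "a \<in> labelled l In" for a
    using that by (simp flip: complete_Out_iff[OF assms])
  show "\<exists>b\<in>B. attacked F (labelled l In) b" if "(B, a) \<in> atts F" "a \<in> labelled l In" for B a
    using complete_In_imp_attacked[OF assms _ that(1)] that(2)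
    by (simp add: complete_Out_iff[OF assms])
qed

text \<open>Dung's fundamental lemma for set attacks. If \<open>S\<close> attacked \<open>a\<close>,
  the defence of \<open>a\<close> would make \<open>S\<close> attack one of its own members.\<close>

lemma admissible_insert:
  assumes "admissible F S" "a \<in> args F"
    and defended: "\<And>B. (B, a) \<in> atts F \<Longrightarrow> \<exists>b\<in>B. attacked F S b"
  shows "admissible F (insert a S)"
proof -
  have def: "\<exists>b\<in>B. attacked F S b" if "(B, c) \<in> atts F" "c \<in> insert a S" for B c
    using that assms unfolding admissible_def by blast
  have free: "\<not> attacked F S c" if "c \<in> insert a S" for c
    using that assms(1) defended unfolding admissible_def attacked_def by blast
  have "\<not> attacked F (insert a S) c" if c: "c \<in> insert a S" for c
  proof
    assume "attacked F (insert a S) c"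
    then obtain B where "(B, c) \<in> atts F" "B \<subseteq> insert a S"
      unfolding attacked_def by blast
    \<comment> \<open>Defence makes \<open>S\<close> attack a member of \<open>B\<close>, yet
      \<open>S\<close> attacks nothing in \<open>insert a S\<close>, which contains
      \<open>B\<close>.\<close>
    then show False using def[OF _ c] free by blast
  qed
  moreover have "\<exists>b\<in>B. attacked F (insert a S) b" if "(B, c) \<in> atts F" "c \<in> insert a S" for B c
    using def[OF that] attacked_mono[of F S _ "insert a S"] by blast
  ultimately show ?thesis
    using assms(1,2) unfolding admissible_def by blast
qed

section \<open>Maximal admissible sets and preferred labellings\<close>

lemma labelled_set_labelling_In:
  "S \<subseteq> args F \<Longrightarrow> labelled (set_labelling F S) In = S"
  by (auto simp: labelled_def set_labelling_def split: if_splits)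

text \<open>Maximality supplies one half of the In-clause: a defended argument can be added by
  \<open>admissible_insert\<close>, so it already lies in \<open>S\<close>.\<close>

lemma maximal_admissible_complete:
  assumes F: "is_setaf F" and S: "admissible F S"
    and max: "\<And>T. admissible F T \<Longrightarrow> S \<subseteq> T \<Longrightarrow> T = S"
  shows "complete F (set_labelling F S)" (is "complete F ?l")
proof -
  have In: "?l a = Some In \<longleftrightarrow> a \<in> S" for a
    using S by (auto simp: set_labelling_def admissible_def)
  have Out: "?l a = Some Out \<longleftrightarrow> attacked F S a" for a
    using S F by (auto simp: set_labelling_def admissible_def attacked_def is_setaf_def)
  have "dom ?l = args F"
    by (auto simp: set_labelling_def split: if_splits)
  moreover have "a \<in> S \<longleftrightarrow> (\<forall>B. (B, a) \<in> atts F \<longrightarrow> (\<exists>b\<in>B. attacked F S b))"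
    if "a \<in> args F" for a
  proof
    show "a \<in> S \<Longrightarrow> \<forall>B. (B, a) \<in> atts F \<longrightarrow> (\<exists>b\<in>B. attacked F S b)"
      using S unfolding admissible_def by blast
    show "a \<in> S" if "\<forall>B. (B, a) \<in> atts F \<longrightarrow> (\<exists>b\<in>B. attacked F S b)"
      using max[OF admissible_insert[OF S \<open>a \<in> args F\<close>]] that by blast
  qed
  moreover have "a \<notin> S \<or> (\<exists>b\<in>B. b \<notin> S)" if "(B, a) \<in> atts F" for B a
    using S that unfolding admissible_def attacked_def by blast
  ultimately show ?thesis
    unfolding complete_def conflict_free_def In Out
    by (auto simp: attacked_def subset_iff)
qed

text \<open>Finiteness gives a maximal admissible set above \<open>S\<close>; no complete labelling
  exceeds it, because In-sets of complete labellings are admissible.\<close>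

lemma admissible_extends_to_preferred:
  assumes F: "is_setaf F" and S: "admissible F S"
  obtains l where "preferred F l" "S \<subseteq> labelled l In"
proof -
  have "{T. admissible F T} \<subseteq> Pow (args F)" by (auto simp: admissible_def)
  then have "finite {T. admissible F T}"
    using F by (meson finite_Pow_iff finite_subset is_setaf_def)
  from finite_has_maximal2[OF this, of S] S obtain M where M: "admissible F M" "S \<subseteq> M"
    and max: "\<And>T. admissible F T \<Longrightarrow> M \<subseteq> T \<Longrightarrow> T = M"
    by auto
  have In: "labelled (set_labelling F M) In = M"
    using M(1) by (simp add: admissible_def labelled_set_labelling_In)
  have "preferred F (set_labelling F M)"
    unfolding preferred_def In
    using maximal_admissible_complete[OF F M(1) max] max complete_imp_admissible[OF F] by blast
  with M(2) show thesis using In by (intro that) auto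
qed

lemma preferred_admissible_maximal:
  assumes "is_setaf F" "preferred F l" "admissible F T" "labelled l In \<subseteq> T"
  shows "labelled l In = T"
proof -
  obtain l' where "preferred F l'" "T \<subseteq> labelled l' In"
    using admissible_extends_to_preferred assms(1,3) .
  then show ?thesis
    using assms(2,4) unfolding preferred_def by blast
qed

text \<open>An attack from within \<open>S \<union> T\<close> on one of its members would contain,
  by defence, an element attacked by \<open>S\<close> or \<open>T\<close>; conflict-freeness and
  \<open>disj\<close> exclude this.\<close>

lemma admissible_Un:
  assumes "admissible F S" "admissible F T"
    and disj: "\<And>a. a \<in> S \<Longrightarrow> \<not> attacked F T a" "\<And>a. a \<in> T \<Longrightarrow> \<not> attacked F S a"
  shows "admissible F (S \<union> T)"
proof -
  have free: "\<not> attacked F S a \<and> \<not> attacked F T a" if "a \<in> S \<union> T" for a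
    using that assms unfolding admissible_def by blast
  have def: "\<exists>b\<in>B. attacked F S b \<or> attacked F T b" if "(B, a) \<in> atts F" "a \<in> S \<union> T" for B a
    using that assms(1,2) unfolding admissible_def by blast
  have "\<not> attacked F (S \<union> T) a" if "a \<in> S \<union> T" for a
    using def[OF _ that] free unfolding attacked_def[of F "S \<union> T"] by blast
  moreover have "\<exists>b\<in>B. attacked F (S \<union> T) b" if "(B, a) \<in> atts F" "a \<in> S \<union> T" for B a
    using def[OF that] attacked_mono[of F _ _ "S \<union> T"] by blast
  ultimately show ?thesis
    using assms(1,2) unfolding admissible_def by blast
qed

section \<open>Preferred labellings satisfy the conditions\<close>

lemma preferred_distinct_In_Out:
  assumes F: "is_setaf F" and pref: "preferred F l1" "preferred F l2" and "l1 \<noteq> l2"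
  shows "\<exists>a. l1 a = Some In \<and> l2 a = Some Out"
proof (rule ccontr)
  assume no: "\<nexists>a. l1 a = Some In \<and> l2 a = Some Out"
  have c: "complete F l1" "complete F l2" using pref by (simp_all add: preferred_def)
  have "\<not> attacked F (labelled l2 In) a" if "a \<in> labelled l1 In" for a
    using that no by (simp flip: complete_Out_iff[OF F c(2)])
  \<comment> \<open>The assumption is one-sided, but defence gives the other direction: an attack by
    In-arguments of \<open>l1\<close> on an In-argument of \<open>l2\<close> has a member that is
    Out in \<open>l2\<close>.\<close>
  moreover have "\<not> attacked F (labelled l1 In) a" if "a \<in> labelled l2 In" for a
    using that no complete_In_imp_attacked[OF F c(2), of a]
    unfolding attacked_def subset_iff mem_labelled by blast
  ultimately have U: "admissible F (labelled l1 In \<union> labelled l2 In)"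
    by (intro admissible_Un complete_imp_admissible F c)
  have "labelled l1 In = labelled l2 In"
    using preferred_admissible_maximal[OF F pref(1) U] preferred_admissible_maximal[OF F pref(2) U]
    by blast
  then show False using complete_eqI[OF F c] \<open>l1 \<noteq> l2\<close> by blast
qed

lemma complete_Out_imp_In:
  assumes "is_setaf F" "complete F l" "l a = Some Out"
  shows "\<exists>b. l b = Some In"
proof -
  obtain B where "(B, a) \<in> atts F" "B \<subseteq> labelled l In"
    using assms(3) unfolding complete_Out_iff[OF assms(1,2)] attacked_def by blast
  moreover then have "B \<noteq> {}" using assms(1) by (auto simp: is_setaf_def)
  ultimately show ?thesis by fastforce
qed

lemma preferred_exists:
  assumes "is_setaf F"
  shows "\<exists>l. preferred F l"
proof -
  have "admissible F {}" by (simp add: admissible_def)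
  then show ?thesis using admissible_extends_to_preferred[OF assms] by metis
qed

section \<open>Realising a set of labellings\<close>

text \<open>An Undec argument attacks itself jointly with the In-set: it cannot be In together with
  that set, and this attack does not make it Out, since one attacker is Undec.\<close>

definition realisation :: "'a set \<Rightarrow> 'a labelling set \<Rightarrow> 'a setaf" where
  "realisation A L = \<lparr>args = A, atts =
     {(labelled l In, a) |l a. l \<in> L \<and> l a = Some Out} \<union>
     {(insert a (labelled l In), a) |l a. l \<in> L \<and> l a = Some Undec}\<rparr>"

locale realisable =
  fixes A :: "'a set" and L :: "'a labelling set"
  assumes finite_args: "finite A"
    and nonempty: "L \<noteq> {}"
    and dom_eq: "l \<in> L \<Longrightarrow> dom l = A"
    and Out_imp_In: "l \<in> L \<Longrightarrow> l a = Some Out \<Longrightarrow> \<exists>b. l b = Some In"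
    and distinct: "l1 \<in> L \<Longrightarrow> l2 \<in> L \<Longrightarrow> l1 \<noteq> l2 \<Longrightarrow> \<exists>a. l1 a = Some In \<and> l2 a = Some Out"
begin

lemma args_realisation [simp]: "args (realisation A L) = A"
  by (simp add: realisation_def)

lemma atts_realisation:
  "(B, a) \<in> atts (realisation A L) \<longleftrightarrow>
     (\<exists>l\<in>L. l a = Some Out \<and> B = labelled l In \<or> l a = Some Undec \<and> B = insert a (labelled l In))"
  by (auto simp: realisation_def)

lemma is_setaf_realisation: "is_setaf (realisation A L)"
proof -
  have "B \<subseteq> A \<and> B \<noteq> {} \<and> a \<in> A" if att: "(B, a) \<in> atts (realisation A L)" for B a
  proof -
    obtain l where l: "l \<in> L"
      and cases: "l a = Some Out \<and> B = labelled l In \<or> l a = Some Undec \<and> B = insert a (labelled l In)"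
      using att unfolding atts_realisation by blast
    have "a \<in> A" "labelled l In \<subseteq> A" using cases dom_eq[OF l] by auto
    \<comment> \<open>Attacks on Undec targets contain the target; only attacks on Out targets could
      be empty, which \<open>Out_imp_In\<close> prevents.\<close>
    moreover have "labelled l In \<noteq> {}" if "l a = Some Out"
      using Out_imp_In[OF l that] by (metis empty_iff mem_labelled)
    ultimately show ?thesis using cases by auto
  qed
  then show ?thesis by (auto simp: is_setaf_def finite_args)
qed

section \<open>Completeness and maximality of the given labellings\<close>

lemma eq_if_In_not_Out:
  assumes "l1 \<in> L" "l2 \<in> L" "\<And>a. l1 a = Some In \<Longrightarrow> l2 a \<noteq> Some Out"
  shows "l1 = l2"
  using distinct assms by blast

text \<open>The attack that \<open>l\<close> itself contributes. Having no Out member, it keeps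
  \<open>a\<close> from being In in \<open>l\<close>; lying in
  \<open>insert a (labelled l In)\<close>, it keeps \<open>a\<close> from joining the
  In-set.\<close>

lemma own_attack:
  assumes "l \<in> L" "a \<in> A" "l a \<noteq> Some In"
  obtains B where "(B, a) \<in> atts (realisation A L)" "B \<subseteq> insert a (labelled l In)"
    "\<And>b. b \<in> B \<Longrightarrow> l b \<noteq> Some Out"
proof -
  from assms(2) dom_eq[OF assms(1)] obtain x where x: "l a = Some x" by blast
  show thesis
  proof (cases x)
    case In
    with x assms(3) show ?thesis by simp
  next
    case Out
    with x have "(labelled l In, a) \<in> atts (realisation A L)"
      using assms(1) by (auto simp: atts_realisation)
    then show ?thesis by (rule that) auto
  next
    case Undec
    with x have "(insert a (labelled l In), a) \<in> atts (realisation A L)"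
      using assms(1) by (auto simp: atts_realisation)
    then show ?thesis by (rule that) (use x Undec in auto)
  qed
qed

lemma In_iff:
  assumes "l \<in> L" "a \<in> A"
  shows "l a = Some In \<longleftrightarrow> (\<forall>B. (B, a) \<in> atts (realisation A L) \<longrightarrow> (\<exists>b\<in>B. l b = Some Out))"
proof
  assume a: "l a = Some In"
  show "\<forall>B. (B, a) \<in> atts (realisation A L) \<longrightarrow> (\<exists>b\<in>B. l b = Some Out)"
  proof (intro allI impI)
    fix B assume "(B, a) \<in> atts (realisation A L)"
    \<comment> \<open>The source \<open>l'\<close> of the attack differs from \<open>l\<close> at
      \<open>a\<close>, so \<open>distinct\<close> yields an In-argument of \<open>l'\<close>, hence
      a member of \<open>B\<close>, that is Out in \<open>l\<close>.\<close>
    then obtain l' where l': "l' \<in> L" "l' a \<noteq> Some In" "labelled l' In \<subseteq> B"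
      unfolding atts_realisation by fastforce
    then have "l' \<noteq> l" using a by auto
    then show "\<exists>b\<in>B. l b = Some Out"
      using distinct[OF l'(1) assms(1)] l'(3) by (auto simp: subset_iff)
  qed
next
  assume "\<forall>B. (B, a) \<in> atts (realisation A L) \<longrightarrow> (\<exists>b\<in>B. l b = Some Out)"
  then show "l a = Some In" using own_attack[OF assms] by metis
qed

lemma Out_iff:
  assumes "l \<in> L"
  shows "l a = Some Out \<longleftrightarrow> (\<exists>B. (B, a) \<in> atts (realisation A L) \<and> (\<forall>b\<in>B. l b = Some In))"
proof
  assume "l a = Some Out"
  then have "(labelled l In, a) \<in> atts (realisation A L)"
    using assms by (auto simp: atts_realisation)
  then show "\<exists>B. (B, a) \<in> atts (realisation A L) \<and> (\<forall>b\<in>B. l b = Some In)"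
    by force
next
  assume "\<exists>B. (B, a) \<in> atts (realisation A L) \<and> (\<forall>b\<in>B. l b = Some In)"
  then obtain B l' where B: "\<forall>b\<in>B. l b = Some In" and l': "l' \<in> L" and
    cases: "l' a = Some Out \<and> B = labelled l' In \<or> l' a = Some Undec \<and> B = insert a (labelled l' In)"
    unfolding atts_realisation by blast
  \<comment> \<open>Either form of \<open>B\<close> contains the In-set of \<open>l'\<close>, so
    nothing In in \<open>l'\<close> is Out in \<open>l\<close>. The Undec form then fails, as it
    puts \<open>a\<close> into \<open>B\<close>.\<close>
  have "l' = l" using cases B by (intro eq_if_In_not_Out[OF l' assms]) auto
  with cases B show "l a = Some Out" by auto
qed

lemma complete_realisation:
  assumes "l \<in> L"
  shows "complete (realisation A L) l"
proof -
  have "l a \<noteq> Some In \<or> (\<exists>b\<in>B. l b \<noteq> Some In)" if "(B, a) \<in> atts (realisation A L)" for B a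
    using Out_iff[OF assms, of a] that by auto
  then show ?thesis
    unfolding complete_def conflict_free_def
    using In_iff[OF assms] Out_iff[OF assms] dom_eq[OF assms] by auto
qed

text \<open>An additional In-argument of \<open>l'\<close> would be hit by the attack from
  \<open>own_attack\<close>, whose members are all In in \<open>l'\<close>, and so would be Out as
  well.\<close>

lemma complete_not_above:
  assumes l: "l \<in> L" and l': "complete (realisation A L) l'" and "labelled l In \<subseteq> labelled l' In"
  shows "l' = l"
proof -
  have "a \<in> labelled l In" if "a \<in> labelled l' In" for a
  proof (rule ccontr)
    assume "a \<notin> labelled l In"
    moreover have "a \<in> A" using that complete_dom[OF l'] by auto
    ultimately obtain B where "(B, a) \<in> atts (realisation A L)" "B \<subseteq> insert a (labelled l In)"
      using own_attack[OF l] by (metis mem_labelled)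
    then have "attacked (realisation A L) (labelled l' In) a"
      using assms(3) that unfolding attacked_def by blast
    then show False
      using that by (simp flip: complete_Out_iff[OF is_setaf_realisation l'])
  qed
  then show ?thesis
    using complete_eqI[OF is_setaf_realisation l' complete_realisation[OF l]] assms(3) by blast
qed

lemma preferred_realisation_iff: "preferred (realisation A L) l \<longleftrightarrow> l \<in> L"
proof
  assume "l \<in> L"
  then show "preferred (realisation A L) l"
    unfolding preferred_def using complete_realisation complete_not_above by blast
next
  assume pref: "preferred (realisation A L) l"
  then have c: "complete (realisation A L) l" by (simp add: preferred_def)
  show "l \<in> L"
  proof (cases "\<exists>a. l a = Some Out")
    case True
    then obtain a B where "(B, a) \<in> atts (realisation A L)" "B \<subseteq> labelled l In"
      unfolding complete_Out_iff[OF is_setaf_realisation c] attacked_def by blast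
    \<comment> \<open>Every attacking set contains the In-set of the labelling it comes
      from.\<close>
    then obtain l' where "l' \<in> L" "labelled l' In \<subseteq> labelled l In"
      unfolding atts_realisation by blast
    then show ?thesis using complete_not_above[OF _ c] by blast
  next
    case False
    \<comment> \<open>The In-arguments of \<open>l\<close> are then unattacked, so every member of \<open>L\<close> labels them In.\<close>
    obtain l' where l': "l' \<in> L" using nonempty by blast
    have "labelled l In \<subseteq> labelled l' In"
    proof
      fix a assume a: "a \<in> labelled l In"
      then have "a \<in> A" using complete_dom[OF c] by auto
      moreover have "(B, a) \<notin> atts (realisation A L)" for B
        using complete_In_imp_attacked[OF is_setaf_realisation c] a False by auto
      ultimately show "a \<in> labelled l' In" using In_iff[OF l'] by simp
    qed
    then have "labelled l In = labelled l' In"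
      using pref complete_realisation[OF l'] unfolding preferred_def by blast
    then show ?thesis using complete_not_above[OF l' c] l' by blast
  qed
qed

end

section \<open>The two inclusions of the characterisation\<close>

theorem proposition4:
  "setaf_signature (prf_labellings :: 'a setaf \<Rightarrow> 'a labelling set) =
     {L. L \<noteq> {} \<and>
         (\<forall>l\<in>L. is_labelling l) \<and>
         (\<exists>Args. \<forall>l\<in>L. dom l = Args) \<and>
         (\<forall>l\<in>L. (\<exists>a. l a = Some Out) \<longrightarrow> (\<exists>a. l a = Some In)) \<and>
         (\<forall>l1\<in>L. \<forall>l2\<in>L. l1 \<noteq> l2 \<longrightarrow> (\<exists>a. l1 a = Some In \<and> l2 a = Some Out))}"
proof (intro equalityI subsetI)
  fix L :: "'a labelling set"
  assume "L \<in> setaf_signature prf_labellings"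
  then obtain F where F: "is_setaf F" and L: "L = {l. preferred F l}"
    by (auto simp: setaf_signature_def prf_labellings_def)
  have c: "complete F l" if "l \<in> L" for l
    using that L by (simp add: preferred_def)
  have "\<forall>l\<in>L. is_labelling l"
    using F complete_dom[OF c] by (simp add: is_labelling_def is_setaf_def)
  moreover have "\<exists>Args. \<forall>l\<in>L. dom l = Args"
    by (intro exI[of _ "args F"] ballI complete_dom c)
  moreover have "\<forall>l\<in>L. (\<exists>a. l a = Some Out) \<longrightarrow> (\<exists>a. l a = Some In)"
    using complete_Out_imp_In[OF F] c by blast
  ultimately show "L \<in> {L. L \<noteq> {} \<and>
         (\<forall>l\<in>L. is_labelling l) \<and>
         (\<exists>Args. \<forall>l\<in>L. dom l = Args) \<and>
         (\<forall>l\<in>L. (\<exists>a. l a = Some Out) \<longrightarrow> (\<exists>a. l a = Some In)) \<and>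
         (\<forall>l1\<in>L. \<forall>l2\<in>L. l1 \<noteq> l2 \<longrightarrow> (\<exists>a. l1 a = Some In \<and> l2 a = Some Out))}"
    using preferred_exists[OF F] preferred_distinct_In_Out[OF F] L by simp
next
  fix L :: "'a labelling set"
  assume "L \<in> {L. L \<noteq> {} \<and>
         (\<forall>l\<in>L. is_labelling l) \<and>
         (\<exists>Args. \<forall>l\<in>L. dom l = Args) \<and>
         (\<forall>l\<in>L. (\<exists>a. l a = Some Out) \<longrightarrow> (\<exists>a. l a = Some In)) \<and>
         (\<forall>l1\<in>L. \<forall>l2\<in>L. l1 \<noteq> l2 \<longrightarrow> (\<exists>a. l1 a = Some In \<and> l2 a = Some Out))}"
  then obtain A where L: "L \<noteq> {}" "\<forall>l\<in>L. is_labelling l" "\<forall>l\<in>L. dom l = A"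
    "\<forall>l\<in>L. (\<exists>a. l a = Some Out) \<longrightarrow> (\<exists>a. l a = Some In)"
    "\<forall>l1\<in>L. \<forall>l2\<in>L. l1 \<noteq> l2 \<longrightarrow> (\<exists>a. l1 a = Some In \<and> l2 a = Some Out)"
    by (elim CollectE conjE exE) (rule that)
  \<comment> \<open>Since \<open>L\<close> is non-empty, \<open>A\<close> is the domain of an actual
    labelling.\<close>
  have "finite A" using L(1-3) by (auto simp: is_labelling_def)
  interpret realisable A L
  proof
    show "\<exists>b. l b = Some In" if "l \<in> L" "l a = Some Out" for l a
      using L(4) that by blast
  qed (simp_all add: L \<open>finite A\<close>)
  have "prf_labellings (realisation A L) = L"
    by (simp add: prf_labellings_def preferred_realisation_iff)
  then show "L \<in> setaf_signature prf_labellings"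
    using is_setaf_realisation unfolding setaf_signature_def by blast
qed

end
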